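(* Let $n\in\mathbb N$ and let $m,M$ be positive real numbers satisfying \[ \frac{n}{M-n+1}\le m\le n-1+\frac{n}{M} \qquad\text{and}\qquad 0<m\le n\le M . \] Then there exists a finite Blaschke product $B$ of degree $n$ with $M(B)=M$ and $m(B)=m$.
   Context: A finite Blaschke product of degree $n$ is a function $B(z)=\alpha\prod_{k=1}^n \frac{z-a_k}{1-\overline{a_k}z}$ with $a_1,\dots,a_n\in\mathbb D=\{|z|<1\}$ and $\alpha\in\mathbb T=\{|z|=1\}$. For such $B$, $M(B)=\sup_{|z|=1}|B'(z)|$ and $m(B)=\inf_{|z|=1}|B'(z)|$. *)

theory Defs
  imports "HOL-Analysis.Analysis"
begin

definition blaschke :: "complex \<Rightarrow> (nat \<Rightarrow> complex) \<Rightarrow> nat \<Rightarrow> complex \<Rightarrow> complex" where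
  "blaschke alpha a n z = alpha * (\<Prod>k<n. (z - a k) / (1 - cnj (a k) * z))"

definition is_blaschke :: "nat \<Rightarrow> (complex \<Rightarrow> complex) \<Rightarrow> bool" where
  "is_blaschke n B \<longleftrightarrow> (\<exists>alpha a. norm alpha = 1 \<and> (\<forall>k<n. norm (a k) < 1) \<and>
      B = blaschke alpha a n)"

definition maxderiv :: "(complex \<Rightarrow> complex) \<Rightarrow> real" where
  "maxderiv B = (SUP z\<in>sphere 0 1. norm (deriv B z))"

definition minderiv :: "(complex \<Rightarrow> complex) \<Rightarrow> real" where
  "minderiv B = (INF z\<in>sphere 0 1. norm (deriv B z))"

end

theory Submission
  imports Defs "HOL-Complex_Analysis.Complex_Analysis"
    "HOL-Computational_Algebra.Fundamental_Theorem_Algebra"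
begin

text \<open>
  On the unit circle \<open>|B'|\<close> is the sum \<open>F\<close> of the Poisson kernels of the zeros of \<open>B\<close>.
  Multiplying all zeros by \<open>t\<close> replaces \<open>F\<close> by a dilation of its harmonic extension, so by the
  maximum principle \<open>max F\<close> is strictly increasing and \<open>min F\<close> is decreasing in \<open>t\<close>. Hence for
  \<open>M > n\<close> each direction in the space of nonzero zero tuples contains exactly one tuple with
  \<open>max F = M\<close>; this tuple depends continuously on the direction, and \<open>min F\<close> takes all values
  between any two of its values on this connected level set.

  It remains to reach the two extreme values. For every zero tuple and every fibre
  \<open>z\<^sub>0, ..., z\<^sub>n\<close> of \<open>z B(z)\<close> one has \<open>\<Sum> 1 / (1 + F(z\<^sub>k)) = 1\<close>, so in an extreme case \<open>F\<close> is
  extremal at \<open>z\<^sub>0 = 1\<close> and has the same critical value at all other \<open>z\<^sub>k\<close>. These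
  \<open>z\<^sub>k\<close> are then in logarithmic equilibrium with a charge \<open>p\<close> at \<open>1\<close>, i.e. they are the
  zeros of \<open>q = U + V\<close>, where \<open>U\<close> is the Szego polynomial of degree \<open>n\<close> for the weight
  \<open>|1 - z| ^ (2 p)\<close> and \<open>V\<close> its reversal, and \<open>B\<close> has the numerator
  \<open>N = p q - (1 - z) q' = 2 p U - (1 - z) U'\<close>. With \<open>s = 2 p + n\<close> one finds
  \<open>z N = (s z - s + p) U + p V\<close> and \<open>F - (n - 1 + p) = (1 - p) (2 Re (s U / N) - 1)\<close>. Since
  \<open>|V| \<le> |U|\<close> for \<open>|z| \<ge> 1\<close>, the zeros of \<open>N\<close> lie in the disc, and \<open>|N - s U| \<le> s |U|\<close> on the
  circle, i.e. \<open>Re (s U / N) \<ge> 1 / 2\<close>. As \<open>F(1) = n / p\<close>, the choices \<open>p = n / M\<close> and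
  \<open>p = M - n + 1\<close> give the two extreme cases.
\<close>

section \<open>Preliminaries\<close>

lemma norm_scaleR_add_le:
  fixes x y :: "'a::real_normed_vector"
  assumes "0 \<le> s" "0 \<le> t" "norm y \<le> norm x"
  shows "norm (s *\<^sub>R x + t *\<^sub>R y) \<le> (s + t) * norm x"
proof -
  have "norm (s *\<^sub>R x + t *\<^sub>R y) \<le> s * norm x + t * norm y"
    using norm_triangle_ineq[of "s *\<^sub>R x" "t *\<^sub>R y"] assms by simp
  also have "\<dots> \<le> (s + t) * norm x"
    using assms by (simp add: distrib_right mult_left_mono)
  finally show ?thesis .
qed

lemma norm_scaleR_add_ge_imp_eq:
  fixes x y :: "'a::real_inner"
  assumes "0 < s" "0 < t" "norm y \<le> norm x" "(s + t) * norm x \<le> norm (s *\<^sub>R x + t *\<^sub>R y)"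
  shows "y = x"
proof -
  have upper: "norm (s *\<^sub>R x + t *\<^sub>R y) \<le> s * norm x + t * norm y" "t * norm y \<le> t * norm x"
    using norm_triangle_ineq[of "s *\<^sub>R x" "t *\<^sub>R y"] assms by (simp_all add: mult_left_mono)
  then have "t * norm y = t * norm x"
    using assms(4) unfolding distrib_right by linarith
  then have y: "norm y = norm x"
    using assms(2) by simp
  have "norm (s *\<^sub>R x + t *\<^sub>R y) = norm (s *\<^sub>R x) + norm (t *\<^sub>R y)"
    using upper assms y by (simp add: distrib_right)
  then have "(s * t * norm x) *\<^sub>R y = (s * t * norm x) *\<^sub>R x"
    unfolding norm_triangle_eq using y assms(1,2) by (simp add: mult_ac)
  then show ?thesis
    using assms(1,2) y by auto
qed

lemma norm_mult_add_mult_swap_le: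
  fixes x y :: complex
  assumes "\<bar>t\<bar> \<le> s" "norm y \<le> norm x"
  shows "norm (of_real s * y + of_real t * x) \<le> norm (of_real s * x + of_real t * y)"
proof (rule power2_le_imp_le)
  have "0 \<le> (s\<^sup>2 - t\<^sup>2) * ((norm x)\<^sup>2 - (norm y)\<^sup>2)"
    using assms by (intro mult_nonneg_nonneg) (auto simp: power_mono abs_le_square_iff[symmetric])
  also have "\<dots> =
      (norm (of_real s * x + of_real t * y))\<^sup>2 - (norm (of_real s * y + of_real t * x))\<^sup>2"
    unfolding cmod_power2 by (simp add: power2_eq_square algebra_simps)
  finally show "(norm (of_real s * y + of_real t * x))\<^sup>2 \<le> (norm (of_real s * x + of_real t * y))\<^sup>2"
    by simp
qed simp

lemma Re_divide_ge_half:
  assumes "w \<noteq> 0" "norm (w - c) \<le> norm c"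
  shows "1 / 2 \<le> Re (c / w)"
proof -
  have "(norm (w - c))\<^sup>2 = (norm w)\<^sup>2 - 2 * Re (c * cnj w) + (norm c)\<^sup>2"
    unfolding cmod_power2 by (simp add: power2_eq_square algebra_simps)
  moreover have "(norm (w - c))\<^sup>2 \<le> (norm c)\<^sup>2"
    using assms(2) by (intro power_mono) auto
  ultimately have "(norm w)\<^sup>2 \<le> 2 * Re (c * cnj w)"
    by linarith
  moreover have "Re (c / w) = Re (c * cnj w) / (norm w)\<^sup>2"
    by (subst complex_div_cnj) (simp flip: of_real_power)
  ultimately show ?thesis
    using assms(1) by (simp add: le_divide_eq)
qed

lemma alg_closed_poly_split_indexed:
  fixes P :: "'a::alg_closed_field poly"
  assumes "P \<noteq> 0"
  obtains a where "P = smult (lead_coeff P) (\<Prod>k<degree P. [:- a k, 1:])"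
proof -
  obtain A where A: "size A = degree P" "P = smult (lead_coeff P) (\<Prod>x\<in>#A. [:- x, 1:])"
    using alg_closed_imp_factorization[OF assms] by blast
  obtain xs where xs: "mset xs = A"
    using ex_mset by blast
  have "(\<Prod>x\<in>#A. [:- x, 1:]) = prod_list (map (\<lambda>x. [:- x, 1:]) xs)"
    by (simp add: prod_mset_prod_list flip: xs mset_map)
  also have "\<dots> = (\<Prod>k<degree P. [:- (xs ! k), 1:])"
    using A(1) xs by (auto simp: prod.list_conv_set_nth atLeast0LessThan)
  finally show ?thesis
    using A(2) that[of "\<lambda>k. xs ! k"] by simp
qed

lemma continuous_on_SUP_compact:
  fixes f :: "'a::topological_space \<times> 'b::topological_space \<Rightarrow> real"
  assumes "continuous_on (X \<times> K) f" "compact K" "K \<noteq> {}"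
  shows "continuous_on X (\<lambda>x. SUP y\<in>K. f (x, y))"
  unfolding continuous_on_def tendsto_iff
proof (intro ballI allI impI)
  fix x0 and e :: real
  assume x0: "x0 \<in> X" and e: "0 < e"
  obtain U where U: "x0 \<in> U" "open U"
      and near: "\<forall>x\<in>U \<inter> X. \<forall>y\<in>K. dist (f (x, y)) (f (x0, y)) \<le> e / 2"
    using continuous_on_prod_compactE[OF assms(1,2) x0 half_gt_zero[OF e]] by metis
  have bdd: "bdd_above ((\<lambda>y. f (x, y)) ` K)" if "x \<in> X" for x
    using that assms
    by (intro bounded_imp_bdd_above compact_imp_bounded compact_continuous_image
        continuous_on_compose2[OF assms(1)] continuous_intros) auto
  have SUP_le: "(SUP y\<in>K. f (x, y)) \<le> (SUP y\<in>K. f (x', y)) + e / 2"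
    if "x' \<in> X" "\<And>y. y \<in> K \<Longrightarrow> f (x, y) \<le> f (x', y) + e / 2" for x x'
  proof (rule cSUP_least[OF assms(3)])
    fix y assume "y \<in> K"
    then have "f (x', y) \<le> (SUP y\<in>K. f (x', y))"
      using bdd[OF that(1)] by (rule cSUP_upper)
    then show "f (x, y) \<le> (SUP y\<in>K. f (x', y)) + e / 2"
      using that(2)[OF \<open>y \<in> K\<close>] by linarith
  qed
  have "dist (SUP y\<in>K. f (x, y)) (SUP y\<in>K. f (x0, y)) < e" if "x \<in> U \<inter> X" for x
  proof -
    have "f (x, y) \<le> f (x0, y) + e / 2" "f (x0, y) \<le> f (x, y) + e / 2" if "y \<in> K" for y
      using near[rule_format, OF \<open>x \<in> U \<inter> X\<close> that] unfolding dist_real_def by linarith+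
    then show ?thesis
      using SUP_le[of x0 x] SUP_le[of x x0] x0 that e unfolding dist_real_def by fastforce
  qed
  then show "\<forall>\<^sub>F x in at x0 within X. dist (SUP y\<in>K. f (x, y)) (SUP y\<in>K. f (x0, y)) < e"
    unfolding eventually_at_topological using U by blast
qed

lemma Re_strong_maximum_principle:
  assumes "f holomorphic_on S" "open S" "connected S" "\<And>z. z \<in> S \<Longrightarrow> Re (f z) \<le> B"
    and "w \<in> S" "Re (f w) < B" "z \<in> S"
  shows "Re (f z) < B"
proof (rule ccontr)
  assume "\<not> Re (f z) < B"
  then have "Re (f z) = B"
    using assms(4,7) by (simp add: not_less antisym)
  then have "(\<lambda>z. exp (f z)) constant_on S"
    using assms by (intro maximum_modulus_principle[of _ _ S z] holomorphic_intros) auto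
  then have "norm (exp (f w)) = norm (exp (f z))"
    using assms(5,7) by (metis constant_on_def)
  then show False
    using \<open>Re (f z) = B\<close> assms(6) by simp
qed

section \<open>The derivative on the unit circle\<close>

definition poisson_kernel :: "complex \<Rightarrow> complex \<Rightarrow> real" where
  "poisson_kernel a z = (1 - (norm a)\<^sup>2) / (norm (z - a))\<^sup>2"

definition poisson_sum :: "nat \<Rightarrow> (nat \<Rightarrow> complex) \<Rightarrow> complex \<Rightarrow> real" where
  "poisson_sum n a z = (\<Sum>k<n. poisson_kernel (a k) z)"

lemma poisson_kernel_eq_Re:
  fixes z :: complex
  assumes "norm z = 1"
  shows "poisson_kernel a z = Re ((z + a) / (z - a))"
proof -
  have "Re ((z + a) * cnj (z - a)) = 1 - (norm a)\<^sup>2"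
    using assms by (simp add: cmod_def power2_eq_square algebra_simps)
  then show ?thesis
    by (simp add: poisson_kernel_def complex_div_cnj[of "z + a"] Re_divide_of_real
        flip: of_real_power)
qed

lemma poisson_kernel_nonneg: "norm a \<le> 1 \<Longrightarrow> 0 \<le> poisson_kernel a z"
  by (simp add: poisson_kernel_def power_le_one)

lemma poisson_sum_nonneg: "(\<And>k. k < n \<Longrightarrow> norm (a k) \<le> 1) \<Longrightarrow> 0 \<le> poisson_sum n a z"
  unfolding poisson_sum_def by (intro sum_nonneg poisson_kernel_nonneg) auto

lemma one_minus_cnj_mult_eq:
  fixes z :: complex
  assumes "norm z = 1"
  shows "1 - cnj a * z = z * cnj (z - a)"
proof -
  have "z * cnj z = 1"
    using assms by (simp flip: complex_norm_square)
  then show ?thesis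
    by (simp add: algebra_simps)
qed

lemma has_field_derivative_blaschke_factor:
  fixes z :: complex
  assumes "norm z = 1" "z \<noteq> a"
  shows "((\<lambda>w. (w - a) / (1 - cnj a * w)) has_field_derivative
           (z - a) / (1 - cnj a * z) * (poisson_kernel a z / z)) (at z)"
proof -
  have z: "z \<noteq> 0" and d: "1 - cnj a * z \<noteq> 0"
    using assms unfolding one_minus_cnj_mult_eq[OF assms(1)] by auto
  have "((\<lambda>w. (w - a) / (1 - cnj a * w)) has_field_derivative
          (1 - cnj a * a) / (1 - cnj a * z)\<^sup>2) (at z)"
    using d by (auto intro!: derivative_eq_intros simp: power2_eq_square divide_simps)
       (simp add: algebra_simps)
  also have "(1 - cnj a * a) / (1 - cnj a * z)\<^sup>2 =
      (z - a) / (1 - cnj a * z) * (poisson_kernel a z / z)"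
  proof -
    have "complex_of_real (poisson_kernel a z) = (1 - cnj a * a) / ((z - a) * cnj (z - a))"
      by (simp only: poisson_kernel_def of_real_divide of_real_diff of_real_1 complex_norm_square)
         (simp only: mult.commute)
    then show ?thesis
      unfolding one_minus_cnj_mult_eq[OF assms(1)] using z assms(2)
      by (simp add: divide_simps power2_eq_square mult_ac)
  qed
  finally show ?thesis .
qed

lemma norm_blaschke:
  fixes z :: complex
  assumes "norm alpha = 1" "norm z = 1" "\<And>k. k < n \<Longrightarrow> a k \<noteq> z"
  shows "norm (blaschke alpha a n z) = 1"
proof -
  have "norm ((z - a k) / (1 - cnj (a k) * z)) = 1" if "k < n" for k
    unfolding one_minus_cnj_mult_eq[OF assms(2)] norm_divide norm_mult complex_mod_cnj
    using assms(2) assms(3)[OF that] by auto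
  then show ?thesis
    using assms(1) by (simp add: blaschke_def norm_mult flip: prod_norm)
qed

lemma has_field_derivative_blaschke:
  fixes z :: complex
  assumes "norm z = 1" "\<And>k. k < n \<Longrightarrow> a k \<noteq> z"
  shows "(blaschke alpha a n has_field_derivative
           blaschke alpha a n z * (poisson_sum n a z / z)) (at z)"
proof -
  define b where "b = (\<lambda>k w. (w - a k) / (1 - cnj (a k) * w))"
  have b: "(b k has_field_derivative b k z * (poisson_kernel (a k) z / z)) (at z)" "b k z \<noteq> 0"
    if "k < n" for k
  proof -
    have "z \<noteq> a k" "z \<noteq> 0"
      using assms(1) assms(2)[OF that] by auto
    then show "(b k has_field_derivative b k z * (poisson_kernel (a k) z / z)) (at z)" "b k z \<noteq> 0"
      unfolding b_def using has_field_derivative_blaschke_factor[OF assms(1)]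
      by (auto simp: one_minus_cnj_mult_eq[OF assms(1)])
  qed
  then have "((\<lambda>w. \<Prod>k<n. b k w) has_field_derivative
      (\<Prod>k<n. b k z) * (\<Sum>k<n. b k z * (poisson_kernel (a k) z / z) / b k z)) (at z)"
    by (intro has_field_derivative_prod') auto
  also have "(\<Sum>k<n. b k z * (poisson_kernel (a k) z / z) / b k z) = poisson_sum n a z / z"
    using b(2) by (simp add: poisson_sum_def sum_divide_distrib)
  finally have "((\<lambda>w. alpha * (\<Prod>k<n. b k w)) has_field_derivative
      alpha * ((\<Prod>k<n. b k z) * (poisson_sum n a z / z))) (at z)"
    by (rule DERIV_cmult)
  then show ?thesis
    by (simp only: blaschke_def[abs_def] b_def mult.assoc)
qed

lemma norm_deriv_blaschke:
  assumes "norm alpha = 1" "\<And>k. k < n \<Longrightarrow> norm (a k) < 1" "norm z = 1"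
  shows "norm (deriv (blaschke alpha a n) z) = poisson_sum n a z"
proof -
  have a: "a k \<noteq> z" if "k < n" for k
    using assms(2)[OF that] assms(3) by auto
  have "deriv (blaschke alpha a n) z = blaschke alpha a n z * (poisson_sum n a z / z)"
    using has_field_derivative_blaschke[OF assms(3) a] by (rule DERIV_imp_deriv)
  moreover have "0 \<le> poisson_sum n a z"
    using assms(2) by (intro poisson_sum_nonneg) (auto intro: less_imp_le)
  ultimately show ?thesis
    using assms(3) norm_blaschke[OF assms(1,3) a] by (simp add: norm_mult norm_divide)
qed

section \<open>Extremal zero tuples\<close>

text \<open>The Szego recursion with reflection coefficients \<open>p / (n + 1 + p)\<close>, cleared of denominators.\<close>

fun szego :: "real \<Rightarrow> nat \<Rightarrow> complex poly" and szego_rev :: "real \<Rightarrow> nat \<Rightarrow> complex poly" where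
  "szego p 0 = 1"
| "szego_rev p 0 = 1"
| "szego p (Suc n) =
     smult (of_real (real (Suc n) + p)) (pCons 0 (szego p n)) + smult (of_real p) (szego_rev p n)"
| "szego_rev p (Suc n) =
     smult (of_real (real (Suc n) + p)) (szego_rev p n) + smult (of_real p) (pCons 0 (szego p n))"

lemma degree_szego:
  assumes "0 < p"
  shows "degree (szego p n) = n \<and> degree (szego_rev p n) \<le> n"
proof (induction n)
  case (Suc n)
  have degree_lead: "degree (smult (of_real (real (Suc n) + p)) (pCons 0 (szego p n))) = Suc n"
  proof (cases "szego p n = 0")
    case True
    then have "n = 0"
      using Suc.IH by simp
    then show ?thesis
      using True by simp
  next
    case False
    moreover have "real (Suc n) + p \<noteq> 0"
      using assms by linarith
    ultimately show ?thesis
      using Suc.IH by (simp del: of_real_add of_nat_Suc)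
  qed
  have "degree (szego p (Suc n)) = Suc n"
    unfolding szego.simps using Suc.IH degree_lead
    by (subst degree_add_eq_left) (auto intro: le_less_trans[OF degree_smult_le])
  moreover have "degree (szego_rev p (Suc n)) \<le> Suc n"
    unfolding szego_rev.simps using Suc.IH
    by (intro degree_add_le order_trans[OF degree_smult_le] order_trans[OF degree_pCons_le]) auto
  ultimately show ?case
    by blast
qed simp

lemma szego_dominates_rev:
  assumes "0 < p" "1 \<le> norm z"
  shows "poly (szego p n) z \<noteq> 0 \<and> norm (poly (szego_rev p n) z) \<le> norm (poly (szego p n) z)"
proof (induction n)
  case (Suc n)
  define x where "x = z * poly (szego p n) z"
  define y where "y = poly (szego_rev p n) z"
  define s where "s = real (Suc n) + p"
  have s: "p < s"
    by (simp add: s_def)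
  have szego_Suc: "poly (szego p (Suc n)) z = of_real s * x + of_real p * y"
    "poly (szego_rev p (Suc n)) z = of_real s * y + of_real p * x"
    by (simp_all add: x_def y_def s_def)
  have "norm (poly (szego p n) z) \<le> norm x"
    using assms(2) by (simp add: x_def norm_mult mult_le_cancel_right1)
  then have yx: "norm y \<le> norm x" and x: "0 < norm x"
    using Suc.IH by (auto simp: y_def intro: less_le_trans)
  have "norm (of_real p * y) \<le> p * norm x"
    using yx assms(1) by (simp add: norm_mult)
  also have "\<dots> < norm (of_real s * x)"
    using x s assms(1) by (simp add: norm_mult)
  finally have "of_real s * x + of_real p * y \<noteq> 0"
    by (metis add_eq_0_iff norm_minus_cancel order_less_irrefl)
  then show ?case
    unfolding szego_Suc using norm_mult_add_mult_swap_le[OF _ yx, of p s] s assms(1) by simp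
qed simp

lemma szego_derivative:
  "z * (1 - z) * poly (pderiv (szego p n)) z =
     (of_real p + of_nat n * (1 - z)) * poly (szego p n) z - of_real p * poly (szego_rev p n) z"
  "(1 - z) * poly (pderiv (szego_rev p n)) z =
     of_real p * (poly (szego_rev p n) z - poly (szego p n) z)"
proof (induction n)
  case 0
  { case 1 show ?case by simp }
  { case 2 show ?case by simp }
next
  case (Suc n)
  have szego_Suc: "poly (szego p (Suc n)) z =
      (of_nat n + 1 + of_real p) * (z * poly (szego p n) z) + of_real p * poly (szego_rev p n) z"
    "poly (szego_rev p (Suc n)) z =
      (of_nat n + 1 + of_real p) * poly (szego_rev p n) z + of_real p * (z * poly (szego p n) z)"
    "poly (pderiv (szego p (Suc n))) z =
      (of_nat n + 1 + of_real p) * (poly (szego p n) z + z * poly (pderiv (szego p n)) z)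
        + of_real p * poly (pderiv (szego_rev p n)) z"
    "poly (pderiv (szego_rev p (Suc n))) z =
      (of_nat n + 1 + of_real p) * poly (pderiv (szego_rev p n)) z
        + of_real p * (poly (szego p n) z + z * poly (pderiv (szego p n)) z)"
    by (simp_all add: pderiv_add pderiv_smult pderiv_pCons algebra_simps)
  have Suc_n: "(of_nat (Suc n) :: complex) = of_nat n + 1"
    by simp
  {
    case 1
    show ?case
      using Suc.IH unfolding szego_Suc Suc_n by algebra
  next
    case 2
    show ?case
      using Suc.IH unfolding szego_Suc by algebra
  }
qed

definition extremal_poly :: "real \<Rightarrow> nat \<Rightarrow> complex poly" where
  "extremal_poly p n = smult (of_real (2 * p)) (szego p n) - [:1, -1:] * pderiv (szego p n)"

lemma mult_extremal_poly:
  "z * poly (extremal_poly p n) z =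
     (of_real (2 * p + real n) * z - of_real (p + real n)) * poly (szego p n) z
       + of_real p * poly (szego_rev p n) z"
  using szego_derivative(1)[of z p n] unfolding extremal_poly_def by simp algebra

lemma degree_extremal_poly:
  assumes "0 < p"
  shows "degree (extremal_poly p n) = n"
proof -
  define L where "L = [:of_real (- (p + real n)), of_real (2 * p + real n):] * szego p n"
  have lead: "2 * p + real n \<noteq> 0" and szego: "szego p n \<noteq> 0"
    using assms szego_dominates_rev[OF assms, of 1 n] by auto
  have L: "degree L = Suc n"
    unfolding L_def using szego lead degree_szego[OF assms, of n]
    by (subst degree_mult_eq) (auto simp del: of_real_add)
  have "poly (pCons 0 (extremal_poly p n)) = poly (L + smult (of_real p) (szego_rev p n))"
    using mult_extremal_poly[of _ p n] by (simp add: L_def fun_eq_iff algebra_simps)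
  then have "pCons 0 (extremal_poly p n) = L + smult (of_real p) (szego_rev p n)"
    by (simp only: poly_eq_poly_eq_iff)
  moreover have "degree (smult (of_real p) (szego_rev p n)) < Suc n"
    using degree_szego[OF assms, of n] by (simp add: le_less_trans[OF degree_smult_le])
  ultimately have "degree (pCons 0 (extremal_poly p n)) = Suc n"
    using L by (simp add: degree_add_eq_left)
  then show ?thesis
    by (auto split: if_splits)
qed

lemma mult_pderiv_extremal_poly:
  "z * poly (pderiv (extremal_poly p n)) z =
     of_real (real n - 1 + p) * poly (extremal_poly p n) z
       + of_real ((1 - p) * (2 * p + real n)) * poly (szego p n) z"
proof -
  define N U V where "N = extremal_poly p n" and "U = szego p n" and "V = szego_rev p n"
  define r where "r = pCons 0 (pderiv N) - smult (of_real (real n - 1 + p)) N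
      - smult (of_real ((1 - p) * (2 * p + real n))) U"
  have "pCons 0 N = [:- of_real (p + real n), of_real (2 * p + real n):] * U + smult (of_real p) V"
    using mult_extremal_poly[of _ p n]
    by (intro poly_eq_poly_eq_iff[THEN iffD1])
       (simp add: N_def U_def V_def fun_eq_iff algebra_simps)
  then have "poly (pderiv (pCons 0 N)) w = poly (pderiv
      ([:- of_real (p + real n), of_real (2 * p + real n):] * U + smult (of_real p) V)) w" for w
    by (simp only:)
  then have pderiv_N: "poly N w + w * poly (pderiv N) w = of_real (2 * p + real n) * poly U w
      + (of_real (2 * p + real n) * w - of_real (p + real n)) * poly (pderiv U) w
      + of_real p * poly (pderiv V) w" for w
    by (simp add: pderiv_pCons pderiv_add pderiv_mult pderiv_smult algebra_simps)
  have "poly ([:1, -1:] * r) w = 0" for w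
  proof -
    have "poly N w = 2 * of_real p * poly U w - (1 - w) * poly (pderiv U) w"
      by (simp add: N_def U_def extremal_poly_def algebra_simps)
    then show ?thesis
      using pderiv_N[of w] mult_extremal_poly[of w p n] szego_derivative(2)[of w p n]
      unfolding N_def[symmetric] U_def[symmetric] V_def[symmetric]
      by (simp add: r_def) algebra
  qed
  then have "[:1, -1:] * r = 0"
    using poly_all_0_iff_0 by blast
  then have "r = 0"
    unfolding mult_eq_0_iff by simp
  then have "poly r z = 0"
    by simp
  then show ?thesis
    by (simp add: r_def N_def U_def algebra_simps)
qed

lemma norm_root_extremal_poly_less_1:
  assumes "0 < p" "poly (extremal_poly p n) z = 0"
  shows "norm z < 1"
proof (rule ccontr)
  assume "\<not> norm z < 1"
  then have z: "1 \<le> norm z"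
    by simp
  define U V where "U = poly (szego p n) z" and "V = poly (szego_rev p n) z"
  define s t where "s = 2 * p + real n" and "t = p + real n"
  have s: "s = t + p" "0 < s" and t: "0 < t"
    using assms(1) by (simp_all add: s_def t_def add_pos_nonneg)
  have U: "U \<noteq> 0" and VU: "norm V \<le> norm U"
    using szego_dominates_rev[OF assms(1) z, of n] by (simp_all add: U_def V_def)
  have root_eq: "t *\<^sub>R U + p *\<^sub>R (- V) = s *\<^sub>R (z * U)"
    using mult_extremal_poly[of z p n] assms(2)
    by (simp add: U_def V_def s_def t_def scaleR_conv_of_real algebra_simps)
  have "(t + p) * norm U \<le> norm (t *\<^sub>R U + p *\<^sub>R (- V))"
    unfolding root_eq using s z by (simp add: norm_mult mult_le_cancel_right1)
  then have "- V = U"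
    using norm_scaleR_add_ge_imp_eq[OF t assms(1)] VU by (metis norm_minus_cancel)
  then have "s *\<^sub>R (z * U) = s *\<^sub>R U"
    using root_eq s(1) by (simp add: scaleR_add_left flip: \<open>- V = U\<close>)
  then have "z = 1"
    using U s(2) by simp
  then have "V = U"
    using szego_derivative(2)[of 1 p n] assms(1) by (simp add: U_def V_def)
  then show False
    using U \<open>- V = U\<close> by simp
qed

definition extremal_ratio :: "real \<Rightarrow> nat \<Rightarrow> complex \<Rightarrow> complex" where
  "extremal_ratio p n z =
     of_real (2 * p + real n) * poly (szego p n) z / poly (extremal_poly p n) z"

lemma Re_extremal_ratio_ge_half:
  assumes "0 < p" "norm z = 1"
  shows "1 / 2 \<le> Re (extremal_ratio p n z)"
  unfolding extremal_ratio_def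
proof (rule Re_divide_ge_half)
  define N U V where "N = poly (extremal_poly p n) z" and "U = poly (szego p n) z"
    and "V = poly (szego_rev p n) z"
  have VU: "norm (- V) \<le> norm U"
    using szego_dominates_rev[OF assms(1), of z n] assms(2) by (simp add: U_def V_def)
  have "z * (N - of_real (2 * p + real n) * U) = - ((p + real n) *\<^sub>R U + p *\<^sub>R (- V))"
    using mult_extremal_poly[of z p n]
    by (simp add: N_def U_def V_def scaleR_conv_of_real algebra_simps)
  then have "norm (N - of_real (2 * p + real n) * U) = norm ((p + real n) *\<^sub>R U + p *\<^sub>R (- V))"
    using assms(2) by (metis mult_1 norm_minus_cancel norm_mult)
  also have "\<dots> \<le> (p + real n + p) * norm U"
    using assms(1) VU by (intro norm_scaleR_add_le) auto
  also have "\<dots> = norm (of_real (2 * p + real n) * U)"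
    using assms(1) by (simp only: norm_mult norm_of_real) simp
  finally show "norm (N - of_real (2 * p + real n) * U) \<le> norm (of_real (2 * p + real n) * U)" .
  show "N \<noteq> 0"
    using norm_root_extremal_poly_less_1[OF assms(1), of n z] assms(2) by (auto simp: N_def)
qed

lemma extremal_ratio_1:
  assumes "0 < p"
  shows "extremal_ratio p n 1 = of_real ((2 * p + real n) / (2 * p))"
  using szego_dominates_rev[OF assms, of 1 n] by (simp add: extremal_ratio_def extremal_poly_def)

lemma poisson_sum_eq_log_derivative:
  assumes "norm z = 1" "P = smult c (\<Prod>k<n. [:- a k, 1:])" "poly P z \<noteq> 0"
  shows "poisson_sum n a z = Re (2 * z * poly (pderiv P) z / poly P z) - real n"
proof -
  have za: "z - a k \<noteq> 0" if "k < n" for k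
    using assms(2,3) that by (auto simp: poly_prod)
  have P: "poly P = (\<lambda>w. c * (\<Prod>k<n. w - a k))"
    by (simp add: assms(2) poly_prod fun_eq_iff)
  have "((\<lambda>w. \<Prod>k<n. w - a k) has_field_derivative (\<Prod>k<n. z - a k) * (\<Sum>k<n. 1 / (z - a k))) (at z)"
    using za by (intro has_field_derivative_prod') (auto intro!: derivative_eq_intros)
  then have "(poly P has_field_derivative poly P z * (\<Sum>k<n. 1 / (z - a k))) (at z)"
    unfolding P mult.assoc by (rule DERIV_cmult)
  then have "poly (pderiv P) z = poly P z * (\<Sum>k<n. 1 / (z - a k))"
    using poly_DERIV DERIV_unique by blast
  then have "2 * z * poly (pderiv P) z / poly P z = 2 * z * (\<Sum>k<n. 1 / (z - a k))"
    using assms(3) by simp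
  also have "\<dots> = (\<Sum>k<n. 2 * z / (z - a k))"
    by (simp add: sum_distrib_left)
  also have "\<dots> = (\<Sum>k<n. (z + a k) / (z - a k) + 1)"
    using za by (intro sum.cong) (auto simp: field_simps)
  finally show ?thesis
    by (simp add: poisson_sum_def poisson_kernel_eq_Re[OF assms(1)] sum.distrib)
qed

lemma poisson_sum_eq_extremal_ratio:
  assumes "norm z = 1" "extremal_poly p n = smult c (\<Prod>k<n. [:- a k, 1:])"
    and "poly (extremal_poly p n) z \<noteq> 0"
  shows "poisson_sum n a z = real n - 1 + p + (1 - p) * (2 * Re (extremal_ratio p n z) - 1)"
proof -
  have "2 * z * poly (pderiv (extremal_poly p n)) z / poly (extremal_poly p n) z =
      of_real (2 * (real n - 1 + p)) + of_real (2 * (1 - p)) * extremal_ratio p n z"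
    using assms(3)
    unfolding mult.assoc mult_pderiv_extremal_poly extremal_ratio_def by (simp add: field_simps)
  then have "Re (2 * z * poly (pderiv (extremal_poly p n)) z / poly (extremal_poly p n) z) =
      2 * (real n - 1 + p) + 2 * (1 - p) * Re (extremal_ratio p n z)"
    by (simp del: of_real_mult of_real_add of_real_diff)
  then show ?thesis
    unfolding poisson_sum_eq_log_derivative[OF assms] by (simp add: algebra_simps)
qed

lemma extremal_zeros:
  assumes "0 < p"
  obtains a where "\<And>k. k < n \<Longrightarrow> norm (a k) < 1"
    and "poisson_sum n a 1 = real n / p"
    and "\<And>z. norm z = 1 \<Longrightarrow> 0 \<le> (1 - p) * (poisson_sum n a z - (real n - 1 + p))"
proof -
  define P where "P = extremal_poly p n"
  have nonzero: "poly P z \<noteq> 0" if "norm z = 1" for z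
    using norm_root_extremal_poly_less_1[OF assms, of n z] that by (auto simp: P_def)
  then have "P \<noteq> 0"
    using norm_one by fastforce
  then obtain a where a: "P = smult (lead_coeff P) (\<Prod>k<n. [:- a k, 1:])"
    using alg_closed_poly_split_indexed degree_extremal_poly[OF assms] unfolding P_def by metis
  have poisson_sum: "poisson_sum n a z =
      real n - 1 + p + (1 - p) * (2 * Re (extremal_ratio p n z) - 1)" if "norm z = 1" for z
    using that a nonzero[OF that] unfolding P_def by (rule poisson_sum_eq_extremal_ratio)
  show ?thesis
  proof
    show "norm (a k) < 1" if "k < n" for k
    proof (rule norm_root_extremal_poly_less_1[OF assms])
      show "poly (extremal_poly p n) (a k) = 0"
        unfolding P_def[symmetric] using that by (subst a) (auto simp: poly_prod)
    qed
    have "poisson_sum n a 1 = real n - 1 + p + (1 - p) * (2 * ((2 * p + real n) / (2 * p)) - 1)"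
      by (simp only: poisson_sum norm_one extremal_ratio_1[OF assms] Re_complex_of_real)
    then show "poisson_sum n a 1 = real n / p"
      using assms by (simp add: field_simps)
    show "0 \<le> (1 - p) * (poisson_sum n a z - (real n - 1 + p))" if "norm z = 1" for z
    proof -
      have "0 \<le> (1 - p)\<^sup>2 * (2 * Re (extremal_ratio p n z) - 1)"
        using Re_extremal_ratio_ge_half[OF assms that, of n] by simp
      then show ?thesis
        by (simp add: poisson_sum[OF that] power2_eq_square mult.assoc)
    qed
  qed
qed

section \<open>Extrema on the circle and dilation of the zeros\<close>

definition tuple_norm :: "nat \<Rightarrow> (nat \<Rightarrow> complex) \<Rightarrow> real" where
  "tuple_norm n a = Max (insert 0 ((\<lambda>k. norm (a k)) ` {..<n}))"

definition tuple_scale :: "complex \<Rightarrow> (nat \<Rightarrow> complex) \<Rightarrow> nat \<Rightarrow> complex" where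
  "tuple_scale c a = (\<lambda>k. c * a k)"

lemma norm_le_tuple_norm: "k < n \<Longrightarrow> norm (a k) \<le> tuple_norm n a"
  unfolding tuple_norm_def by (intro Max_ge) auto

lemma tuple_norm_less_iff: "0 < r \<Longrightarrow> tuple_norm n a < r \<longleftrightarrow> (\<forall>k<n. norm (a k) < r)"
  unfolding tuple_norm_def by (subst Max_less_iff) auto

lemma tuple_norm_pos_iff: "0 < tuple_norm n a \<longleftrightarrow> (\<exists>k<n. a k \<noteq> 0)"
  unfolding tuple_norm_def by (subst Max_gr_iff) auto

lemma tuple_norm_nonneg: "0 \<le> tuple_norm n a"
  unfolding tuple_norm_def by (intro Max_ge) auto

lemma tuple_norm_attained:
  assumes "0 < tuple_norm n a"
  obtains k where "k < n" "norm (a k) = tuple_norm n a"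
proof -
  have "tuple_norm n a \<in> insert 0 ((\<lambda>k. norm (a k)) ` {..<n})"
    unfolding tuple_norm_def by (intro Max_in) auto
  then show ?thesis
    using assms that by auto
qed

lemma tuple_norm_Suc: "tuple_norm (Suc n) a = max (norm (a n)) (tuple_norm n a)"
  by (simp add: tuple_norm_def lessThan_Suc insert_commute[of 0])

lemma continuous_on_tuple_norm:
  assumes "\<And>k. k < n \<Longrightarrow> continuous_on X (\<lambda>x. a x k)"
  shows "continuous_on X (\<lambda>x. tuple_norm n (a x))"
  using assms
proof (induction n)
  case 0
  show ?case
    by (simp add: tuple_norm_def)
next
  case (Suc n)
  then show ?case
    unfolding tuple_norm_Suc by (intro continuous_on_max continuous_on_norm) auto
qed

lemma tuple_norm_scale: "tuple_norm n (tuple_scale c a) = norm c * tuple_norm n a"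
proof (induction n)
  case 0
  show ?case
    by (simp add: tuple_norm_def)
next
  case (Suc n)
  then show ?case
    by (simp add: tuple_norm_Suc tuple_scale_def norm_mult max_mult_distrib_left)
qed

lemma tuple_norm_zero: "tuple_norm n (\<lambda>k. 0) = 0"
  using tuple_norm_scale[of n 0] by (simp add: tuple_scale_def)

lemma tuple_scale_scale: "tuple_scale c (tuple_scale d a) = tuple_scale (c * d) a"
  by (simp add: tuple_scale_def mult.assoc)

lemma tuple_scale_one: "tuple_scale 1 a = a"
  by (simp add: tuple_scale_def)

definition circle_max :: "nat \<Rightarrow> (nat \<Rightarrow> complex) \<Rightarrow> real" where
  "circle_max n a = (SUP z\<in>sphere 0 1. poisson_sum n a z)"

definition circle_min :: "nat \<Rightarrow> (nat \<Rightarrow> complex) \<Rightarrow> real" where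
  "circle_min n a = (INF z\<in>sphere 0 1. poisson_sum n a z)"

lemma maxderiv_blaschke:
  assumes "norm alpha = 1" "tuple_norm n a < 1"
  shows "maxderiv (blaschke alpha a n) = circle_max n a"
  unfolding maxderiv_def circle_max_def
  using norm_deriv_blaschke[OF assms(1)] assms(2)
  by (intro SUP_cong) (auto simp: tuple_norm_less_iff)

lemma minderiv_blaschke:
  assumes "norm alpha = 1" "tuple_norm n a < 1"
  shows "minderiv (blaschke alpha a n) = circle_min n a"
  unfolding minderiv_def circle_min_def
  using norm_deriv_blaschke[OF assms(1)] assms(2)
  by (intro INF_cong) (auto simp: tuple_norm_less_iff)

lemma continuous_on_poisson_sum:
  assumes "\<And>x. x \<in> X \<Longrightarrow> tuple_norm n (a x) < 1"
    and "\<And>k. k < n \<Longrightarrow> continuous_on X (\<lambda>x. a x k)"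
  shows "continuous_on (X \<times> sphere 0 1) (\<lambda>(x, z). poisson_sum n (a x) z)"
proof -
  have "z \<noteq> a x k" if "x \<in> X" "norm z = 1" "k < n" for x z k
    using that norm_le_tuple_norm[of k n "a x"] assms(1)[of x] by auto
  then show ?thesis
    unfolding poisson_sum_def poisson_kernel_def case_prod_unfold
    by (intro continuous_intros continuous_on_compose2[OF assms(2) continuous_on_fst]) auto
qed

lemma compact_poisson_sum_image:
  assumes "tuple_norm n a < 1"
  shows "compact (poisson_sum n a ` sphere 0 1)"
proof (rule compact_continuous_image)
  have "continuous_on ({0::real} \<times> sphere 0 1) (\<lambda>(x, z). poisson_sum n a z)"
    using assms by (intro continuous_on_poisson_sum) auto
  then have "continuous_on (sphere 0 1) (\<lambda>z. case (0::real, z) of (x, z) \<Rightarrow> poisson_sum n a z)"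
    by (rule continuous_on_compose2) (auto intro!: continuous_intros)
  then show "continuous_on (sphere 0 1) (poisson_sum n a)"
    by simp
qed simp

lemma poisson_sum_le_circle_max:
  assumes "tuple_norm n a < 1" "norm z = 1"
  shows "poisson_sum n a z \<le> circle_max n a"
  unfolding circle_max_def
  using assms compact_imp_bounded[OF compact_poisson_sum_image]
  by (intro cSUP_upper bounded_imp_bdd_above) auto

lemma circle_min_le_poisson_sum:
  assumes "tuple_norm n a < 1" "norm z = 1"
  shows "circle_min n a \<le> poisson_sum n a z"
  unfolding circle_min_def
  using assms compact_imp_bounded[OF compact_poisson_sum_image]
  by (intro cINF_lower bounded_imp_bdd_below) auto

lemma circle_max_attained:
  assumes "tuple_norm n a < 1"
  obtains z where "norm z = 1" "poisson_sum n a z = circle_max n a"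
proof -
  have "circle_max n a \<in> poisson_sum n a ` sphere 0 1"
    unfolding circle_max_def using compact_poisson_sum_image[OF assms]
    by (intro closed_contains_Sup)
       (auto simp: compact_imp_closed compact_imp_bounded bounded_imp_bdd_above)
  then show ?thesis
    using that by auto
qed

lemma circle_max_le:
  assumes "\<And>z. norm z = 1 \<Longrightarrow> poisson_sum n a z \<le> M"
  shows "circle_max n a \<le> M"
  unfolding circle_max_def using assms by (intro cSUP_least) auto

lemma circle_min_ge:
  assumes "\<And>z. norm z = 1 \<Longrightarrow> m \<le> poisson_sum n a z"
  shows "m \<le> circle_min n a"
  unfolding circle_min_def using assms by (intro cINF_greatest) auto

lemma circle_extrema_zero:
  assumes "tuple_norm n a = 0"
  shows "circle_max n a = real n" "circle_min n a = real n"
proof -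
  have zero: "a k = 0" if "k < n" for k
    using norm_le_tuple_norm[OF that, of a] assms by simp
  have "poisson_sum n a ` sphere 0 1 = (\<lambda>z::complex. real n) ` sphere 0 1"
    by (intro image_cong refl) (simp add: zero poisson_sum_def poisson_kernel_def)
  then show "circle_max n a = real n" "circle_min n a = real n"
    by (simp_all add: circle_max_def circle_min_def image_constant_conv)
qed

lemma continuous_on_circle_extrema:
  assumes "\<And>x. x \<in> X \<Longrightarrow> tuple_norm n (a x) < 1"
    and "\<And>k. k < n \<Longrightarrow> continuous_on X (\<lambda>x. a x k)"
  shows "continuous_on X (\<lambda>x. circle_max n (a x))" "continuous_on X (\<lambda>x. circle_min n (a x))"
proof -
  have F: "continuous_on (X \<times> sphere 0 1) (\<lambda>(x, z). poisson_sum n (a x) z)"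
    using assms by (rule continuous_on_poisson_sum)
  then show "continuous_on X (\<lambda>x. circle_max n (a x))"
    using continuous_on_SUP_compact[OF F] by (simp add: circle_max_def)
  have "continuous_on X (\<lambda>x. - (SUP z\<in>sphere 0 1. - poisson_sum n (a x) z))"
    using continuous_on_SUP_compact[OF continuous_on_minus[OF F]]
    by (intro continuous_on_minus) (simp add: case_prod_unfold)
  then show "continuous_on X (\<lambda>x. circle_min n (a x))"
    by (simp add: circle_min_def Inf_real_def image_image)
qed

definition herglotz :: "nat \<Rightarrow> (nat \<Rightarrow> complex) \<Rightarrow> complex \<Rightarrow> complex" where
  "herglotz n a w = (\<Sum>k<n. (1 + cnj (a k) * w) / (1 - cnj (a k) * w))"

lemma Re_herglotz:
  assumes "norm z = 1"
  shows "Re (herglotz n a z) = poisson_sum n a z"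
proof -
  have "(1 + cnj (a k) * z) / (1 - cnj (a k) * z) = cnj ((z + a k) / (z - a k))" for k
    using assms one_minus_cnj_mult_eq[of z "a k"] one_minus_cnj_mult_eq[of z "- a k"] by auto
  then show ?thesis
    by (simp only: herglotz_def poisson_sum_def poisson_kernel_eq_Re[OF assms] Re_sum cnj.sel)
qed

lemma herglotz_scale: "herglotz n (tuple_scale c a) w = herglotz n a (cnj c * w)"
  by (simp add: herglotz_def tuple_scale_def mult_ac)

lemma one_minus_cnj_mult_nonzero:
  assumes "norm a < 1" "norm w \<le> 1"
  shows "1 - cnj a * w \<noteq> 0"
proof -
  have "norm (cnj a * w) \<le> norm a"
    using assms(2) by (simp add: norm_mult mult_left_le)
  then show ?thesis
    using assms(1) by (metis eq_iff_diff_eq_0 norm_one not_less)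
qed

lemma holomorphic_on_herglotz:
  assumes "tuple_norm n a < 1"
  shows "herglotz n a holomorphic_on ball 0 1"
  unfolding herglotz_def[abs_def] using assms one_minus_cnj_mult_nonzero
  by (auto intro!: holomorphic_intros simp: tuple_norm_less_iff)

lemma continuous_on_herglotz:
  assumes "tuple_norm n a < 1"
  shows "continuous_on (cball 0 1) (herglotz n a)"
  unfolding herglotz_def[abs_def] using assms one_minus_cnj_mult_nonzero
  by (auto intro!: continuous_intros simp: tuple_norm_less_iff)

lemma Re_herglotz_le_circle_max:
  assumes "tuple_norm n a < 1" "norm w \<le> 1"
  shows "Re (herglotz n a w) \<le> circle_max n a"
proof (rule maximum_real_frontier[of "herglotz n a" "cball 0 1"])
  show "Re (herglotz n a z) \<le> circle_max n a" if "z \<in> frontier (cball 0 1)" for z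
    using that assms(1) by (simp add: Re_herglotz poisson_sum_le_circle_max)
qed (use assms holomorphic_on_herglotz[OF assms(1)] continuous_on_herglotz[OF assms(1)] in auto)

lemma circle_min_le_Re_herglotz:
  assumes "tuple_norm n a < 1" "norm w \<le> 1"
  shows "circle_min n a \<le> Re (herglotz n a w)"
proof -
  have "Re (- herglotz n a w) \<le> - circle_min n a"
  proof (rule maximum_real_frontier[of "\<lambda>w. - herglotz n a w" "cball 0 1"])
    show "Re (- herglotz n a z) \<le> - circle_min n a" if "z \<in> frontier (cball 0 1)" for z
      using that assms(1) by (simp add: Re_herglotz circle_min_le_poisson_sum)
  qed (use assms holomorphic_on_herglotz[OF assms(1)] continuous_on_herglotz[OF assms(1)] in
      \<open>auto intro!: holomorphic_intros continuous_intros\<close>)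
  then show ?thesis
    by simp
qed

lemma circle_max_scale_le:
  assumes "tuple_norm n a < 1" "norm c \<le> 1"
  shows "circle_max n (tuple_scale c a) \<le> circle_max n a"
proof (rule circle_max_le)
  fix z :: complex
  assume "norm z = 1"
  then show "poisson_sum n (tuple_scale c a) z \<le> circle_max n a"
    using Re_herglotz_le_circle_max[OF assms(1), of "cnj c * z"] assms(2)
    by (simp add: norm_mult herglotz_scale flip: Re_herglotz)
qed

lemma circle_min_scale_ge:
  assumes "tuple_norm n a < 1" "norm c \<le> 1"
  shows "circle_min n a \<le> circle_min n (tuple_scale c a)"
proof (rule circle_min_ge)
  fix z :: complex
  assume "norm z = 1"
  then show "circle_min n a \<le> poisson_sum n (tuple_scale c a) z"
    using circle_min_le_Re_herglotz[OF assms(1), of "cnj c * z"] assms(2)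
    by (simp add: norm_mult herglotz_scale flip: Re_herglotz)
qed

lemma circle_max_scale_less:
  assumes "tuple_norm n a < 1" "norm c < 1" "real n < circle_max n a"
  shows "circle_max n (tuple_scale c a) < circle_max n a"
proof -
  have "norm c * tuple_norm n a \<le> tuple_norm n a"
    using assms(2) by (simp add: mult_left_le_one_le tuple_norm_nonneg)
  then have "tuple_norm n (tuple_scale c a) < 1"
    using assms(1) by (simp add: tuple_norm_scale)
  then obtain z where z: "norm z = 1"
      "poisson_sum n (tuple_scale c a) z = circle_max n (tuple_scale c a)"
    by (rule circle_max_attained)
  have "Re (herglotz n a (cnj c * z)) < circle_max n a"
  proof (rule Re_strong_maximum_principle[of "herglotz n a" "ball 0 1" _ 0])
    show "Re (herglotz n a 0) < circle_max n a"
      using assms(3) by (simp add: herglotz_def)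
    show "Re (herglotz n a w) \<le> circle_max n a" if "w \<in> ball 0 1" for w
      using that by (intro Re_herglotz_le_circle_max[OF assms(1)]) simp
  qed (use assms(2) z(1) holomorphic_on_herglotz[OF assms(1)] in \<open>auto simp: norm_mult\<close>)
  then show ?thesis
    using z by (simp add: herglotz_scale flip: Re_herglotz)
qed

lemma circle_extrema_rotate:
  assumes "tuple_norm n a < 1" "norm c = 1"
  shows "circle_max n (tuple_scale c a) = circle_max n a"
    and "circle_min n (tuple_scale c a) = circle_min n a"
proof -
  have inverse_scale: "tuple_scale (cnj c) (tuple_scale c a) = a"
    using assms(2) by (simp add: tuple_scale_scale tuple_scale_one mult.commute[of "cnj c"]
        flip: complex_norm_square)
  have "tuple_norm n (tuple_scale c a) < 1"
    using assms by (simp add: tuple_norm_scale)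
  then show "circle_max n (tuple_scale c a) = circle_max n a"
    and "circle_min n (tuple_scale c a) = circle_min n a"
    using circle_max_scale_le[of n _ "cnj c"] circle_max_scale_le[of n a c]
      circle_min_scale_ge[of n _ "cnj c"] circle_min_scale_ge[of n a c] assms inverse_scale
    by (force intro: antisym)+
qed

section \<open>Level sets of the maximum\<close>

lemma circle_max_ge_of_tuple_norm:
  assumes "tuple_norm n a < 1" "0 < tuple_norm n a"
  shows "(1 + tuple_norm n a) / (1 - tuple_norm n a) \<le> circle_max n a"
proof -
  obtain j where j: "j < n" "norm (a j) = tuple_norm n a"
    using tuple_norm_attained[OF assms(2)] .
  define z where "z = sgn (a j)"
  have z: "norm z = 1"
    using j assms(2) by (auto simp: z_def norm_sgn)
  have "z - a j = of_real (1 - norm (a j)) * z"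
    using assms(2) j by (auto simp: z_def sgn_eq field_simps)
  then have "norm (z - a j) = 1 - tuple_norm n a"
    using assms(1) j(2) z by (simp add: norm_mult del: of_real_diff)
  then have "(1 + tuple_norm n a) / (1 - tuple_norm n a) = poisson_kernel (a j) z"
    using assms(1) j(2) by (simp add: poisson_kernel_def power2_eq_square divide_simps)
       (simp add: algebra_simps)
  also have "\<dots> \<le> poisson_sum n a z"
    unfolding poisson_sum_def
    using j(1) norm_le_tuple_norm[of _ n a] assms(1)
    by (intro member_le_sum poisson_kernel_nonneg) force+
  also have "\<dots> \<le> circle_max n a"
    using assms(1) z by (rule poisson_sum_le_circle_max)
  finally show ?thesis .
qed

lemma tuple_norm_le_of_circle_max_le:
  assumes "tuple_norm n a < 1" "0 < tuple_norm n a" "circle_max n a \<le> M"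
  shows "tuple_norm n a \<le> (M - 1) / (M + 1)"
proof -
  have M: "(1 + tuple_norm n a) / (1 - tuple_norm n a) \<le> M"
    using circle_max_ge_of_tuple_norm[OF assms(1,2)] assms(3) by linarith
  moreover have "0 < (1 + tuple_norm n a) / (1 - tuple_norm n a)"
    using assms(1,2) by simp
  ultimately have "0 < M + 1"
    by linarith
  with M show ?thesis
    using assms(1) by (simp add: divide_simps algebra_simps split: if_splits)
qed

definition is_level_factor :: "nat \<Rightarrow> real \<Rightarrow> (nat \<Rightarrow> complex) \<Rightarrow> real \<Rightarrow> bool" where
  "is_level_factor n M a t \<longleftrightarrow> 0 \<le> t \<and> tuple_norm n (tuple_scale (of_real t) a) < 1 \<and>
     circle_max n (tuple_scale (of_real t) a) = M"

definition level_factor :: "nat \<Rightarrow> real \<Rightarrow> (nat \<Rightarrow> complex) \<Rightarrow> real" where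
  "level_factor n M a = (THE t. is_level_factor n M a t)"

definition level_tuple :: "nat \<Rightarrow> real \<Rightarrow> (nat \<Rightarrow> complex) \<Rightarrow> nat \<Rightarrow> complex" where
  "level_tuple n M a = tuple_scale (of_real (level_factor n M a)) a"

lemma is_level_factor_bounds:
  assumes "is_level_factor n M a t" "real n < M"
  shows "0 < t" "t * tuple_norm n a \<le> (M - 1) / (M + 1)"
proof -
  have norm: "tuple_norm n (tuple_scale (of_real t) a) = t * tuple_norm n a"
    using assms(1) by (simp add: is_level_factor_def tuple_norm_scale)
  have "tuple_norm n (tuple_scale (of_real t) a) \<noteq> 0"
    using circle_extrema_zero(1) assms by (force simp: is_level_factor_def)
  then have pos: "0 < tuple_norm n (tuple_scale (of_real t) a)"
    by (simp add: order_less_le tuple_norm_nonneg)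
  then show "0 < t"
    using assms(1) norm by (auto simp: is_level_factor_def order_less_le)
  show "t * tuple_norm n a \<le> (M - 1) / (M + 1)"
    using tuple_norm_le_of_circle_max_le[OF _ pos] assms(1) norm by (simp add: is_level_factor_def)
qed

lemma ex_is_level_factor:
  assumes "0 < tuple_norm n a" "real n < M"
  obtains t where "is_level_factor n M a t"
proof -
  obtain k where "k < n"
    using tuple_norm_attained[OF assms(1)] .
  then have M: "1 < M"
    using assms(2) by linarith
  define r where "r = (M - 1) / (M + 1)"
  have r: "0 < r" "r < 1" "(1 + r) / (1 - r) = M"
    using M by (simp_all add: r_def field_simps)
  define T where "T = r / tuple_norm n a"
  have T: "0 < T" "T * tuple_norm n a = r"
    using assms(1) r(1) by (simp_all add: T_def)
  have small: "tuple_norm n (tuple_scale (of_real t) a) < 1" if "t \<in> {0..T}" for t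
  proof -
    have "t * tuple_norm n a \<le> T * tuple_norm n a"
      using that assms(1) by simp
    then show ?thesis
      using that T(2) r(2) by (simp add: tuple_norm_scale)
  qed
  have "continuous_on {0..T} (\<lambda>t. circle_max n (tuple_scale (of_real t) a))"
    using small unfolding tuple_scale_def
    by (intro continuous_on_circle_extrema continuous_intros)
  moreover have "circle_max n (tuple_scale (of_real 0) a) \<le> M"
    using circle_extrema_zero(1)[of n "tuple_scale 0 a"] assms(2) by (simp add: tuple_norm_scale)
  moreover have "M \<le> circle_max n (tuple_scale (of_real T) a)"
    using circle_max_ge_of_tuple_norm[OF small[of T]] T r by (simp add: tuple_norm_scale)
  ultimately obtain t where "0 \<le> t" "t \<le> T" "circle_max n (tuple_scale (of_real t) a) = M"
    using IVT'[of "\<lambda>t. circle_max n (tuple_scale (of_real t) a)" 0 M T] T(1) by auto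
  then show ?thesis
    using small[of t] that[of t] by (simp add: is_level_factor_def)
qed

lemma is_level_factor_unique:
  assumes "is_level_factor n M a s" "is_level_factor n M a t" "real n < M"
  shows "s = t"
proof -
  have "\<not> u < v" if "is_level_factor n M a u" "is_level_factor n M a v" for u v
  proof
    assume "u < v"
    have "0 < u" "0 < v"
      using is_level_factor_bounds(1) that assms(3) by blast+
    then have "circle_max n (tuple_scale (of_real (u / v)) (tuple_scale (of_real v) a)) < M"
      using circle_max_scale_less[of n "tuple_scale (of_real v) a" "of_real (u / v)"] that(2)
        \<open>u < v\<close> assms(3) by (simp add: is_level_factor_def norm_divide)
    then show False
      using that(1) \<open>0 < v\<close> by (simp add: is_level_factor_def tuple_scale_scale)
  qed
  then show ?thesis
    using assms(1,2) by (meson linorder_less_linear)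
qed

lemma is_level_factor_iff:
  assumes "0 < tuple_norm n a" "real n < M"
  shows "is_level_factor n M a t \<longleftrightarrow> t = level_factor n M a"
proof -
  obtain u where u: "is_level_factor n M a u"
    using ex_is_level_factor[OF assms] .
  then have "level_factor n M a = u"
    unfolding level_factor_def using is_level_factor_unique assms(2) by blast
  then show ?thesis
    using u is_level_factor_unique assms(2) by blast
qed

lemma is_level_factor_level_factor:
  assumes "0 < tuple_norm n a" "real n < M"
  shows "is_level_factor n M a (level_factor n M a)"
  by (simp add: is_level_factor_iff[OF assms])

lemma level_factor_pos:
  assumes "0 < tuple_norm n a" "real n < M"
  shows "0 < level_factor n M a"
  using is_level_factor_level_factor[OF assms] assms(2) by (rule is_level_factor_bounds(1))

lemma tuple_norm_level_tuple:
  assumes "0 < tuple_norm n a" "real n < M"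
  shows "tuple_norm n (level_tuple n M a) < 1"
  using is_level_factor_level_factor[OF assms] by (simp add: is_level_factor_def level_tuple_def)

lemma circle_max_level_tuple:
  assumes "0 < tuple_norm n a" "real n < M"
  shows "circle_max n (level_tuple n M a) = M"
  using is_level_factor_level_factor[OF assms] by (simp add: is_level_factor_def level_tuple_def)

lemma circle_min_le_level_tuple:
  assumes "tuple_norm n a < 1" "0 < tuple_norm n a" "real n < M" "M \<le> circle_max n a"
  shows "circle_min n a \<le> circle_min n (level_tuple n M a)"
proof -
  define t where "t = level_factor n M a"
  have level: "level_tuple n M a = tuple_scale (of_real t) a"
    by (simp add: level_tuple_def t_def)
  have t: "0 < t"
    unfolding t_def using assms(2,3) by (rule level_factor_pos)
  then have a: "a = tuple_scale (of_real (inverse t)) (level_tuple n M a)"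
    by (simp add: level tuple_scale_scale tuple_scale_one)
  have "\<not> 1 < t"
  proof
    assume "1 < t"
    then have "circle_max n a < circle_max n (level_tuple n M a)"
      using circle_max_scale_less[of n "level_tuple n M a" "of_real (inverse t)"]
        tuple_norm_level_tuple[OF assms(2,3)] circle_max_level_tuple[OF assms(2,3)] assms(3) a
      by (simp add: norm_inverse inverse_less_1_iff)
    then show False
      using circle_max_level_tuple[OF assms(2,3)] assms(4) by simp
  qed
  then show ?thesis
    unfolding level using t by (intro circle_min_scale_ge assms(1)) simp
qed

lemma level_tuple_le_circle_min:
  assumes "tuple_norm n a < 1" "0 < tuple_norm n a" "real n < M" "circle_max n a \<le> M"
  shows "circle_min n (level_tuple n M a) \<le> circle_min n a"
proof -
  define t where "t = level_factor n M a"
  have level: "level_tuple n M a = tuple_scale (of_real t) a"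
    by (simp add: level_tuple_def t_def)
  have t: "0 < t"
    unfolding t_def using assms(2,3) by (rule level_factor_pos)
  have "\<not> t < 1"
  proof
    assume "t < 1"
    then have "circle_max n (level_tuple n M a) \<le> circle_max n a"
      unfolding level using t by (intro circle_max_scale_le assms(1)) simp
    then have "real n < circle_max n a"
      using circle_max_level_tuple[OF assms(2,3)] assms(3) by simp
    then have "circle_max n (level_tuple n M a) < circle_max n a"
      unfolding level using t \<open>t < 1\<close> by (intro circle_max_scale_less assms(1)) simp_all
    then show False
      using circle_max_level_tuple[OF assms(2,3)] assms(4) by simp
  qed
  then have "circle_min n (level_tuple n M a) \<le>
      circle_min n (tuple_scale (of_real (inverse t)) (level_tuple n M a))"
    using t tuple_norm_level_tuple[OF assms(2,3)]
    by (intro circle_min_scale_ge) (simp_all add: norm_inverse inverse_le_1_iff)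
  also have "tuple_scale (of_real (inverse t)) (level_tuple n M a) = a"
    using t by (simp add: level tuple_scale_scale tuple_scale_one)
  finally show ?thesis .
qed

lemma closed_is_level_factor:
  fixes f :: "'a::topological_space \<Rightarrow> nat \<Rightarrow> complex"
  assumes "closed X" "real n < M" and cont: "\<And>k. k < n \<Longrightarrow> continuous_on X (\<lambda>x. f x k)"
  shows "closed {y \<in> X \<times> {0..}. is_level_factor n M (f (fst y)) (snd y)}"
proof -
  define r where "r = (M - 1) / (M + 1)"
  define h where "h = (\<lambda>y. tuple_scale (complex_of_real (snd y)) (f (fst y)))"
  define Y where "Y = {y \<in> X \<times> {0..}. tuple_norm n (h y) \<le> r}"
  have "0 < M"
    using assms(2) by (meson of_nat_0_le_iff order_le_less_trans)
  then have r: "r < 1"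
    by (simp add: r_def)
  have h: "continuous_on (X \<times> {0..}) (\<lambda>y. h y k)" if "k < n" for k
    unfolding h_def tuple_scale_def
    by (intro continuous_intros continuous_on_compose2[OF cont[OF that] continuous_on_fst]) auto
  have Y: "closed Y"
    unfolding Y_def using assms(1)
    by (intro continuous_on_closed_Collect_le continuous_on_tuple_norm h continuous_on_const
        closed_Times) auto
  have "{y \<in> X \<times> {0..}. is_level_factor n M (f (fst y)) (snd y)} =
      Y \<inter> (\<lambda>y. circle_max n (h y)) -` {M}"
    using r is_level_factor_bounds(2)[OF _ assms(2)]
    by (auto simp: Y_def h_def r_def is_level_factor_def tuple_norm_scale)
  moreover have "continuous_on Y (\<lambda>y. circle_max n (h y))"
    using r by (intro continuous_on_circle_extrema continuous_on_subset[OF h]) (auto simp: Y_def)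
  then have "closed (Y \<inter> (\<lambda>y. circle_max n (h y)) -` {M})"
    using Y by (intro continuous_closed_preimage) auto
  ultimately show ?thesis
    by simp
qed

lemma continuous_on_level_factor:
  fixes f :: "'a::euclidean_space \<Rightarrow> nat \<Rightarrow> complex"
  assumes "compact X" "real n < M" "\<And>x. x \<in> X \<Longrightarrow> 0 < tuple_norm n (f x)"
    and cont: "\<And>k. k < n \<Longrightarrow> continuous_on X (\<lambda>x. f x k)"
  shows "continuous_on X (\<lambda>x. level_factor n M (f x))"
proof (cases "X = {}")
  case False
  have "continuous_on X (\<lambda>x. tuple_norm n (f x))"
    using cont by (rule continuous_on_tuple_norm)
  then obtain x0 where x0: "x0 \<in> X" "\<And>x. x \<in> X \<Longrightarrow> tuple_norm n (f x0) \<le> tuple_norm n (f x)"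
    using continuous_attains_inf[OF assms(1) False] by blast
  define T where "T = (M - 1) / (M + 1) / tuple_norm n (f x0)"
  have level: "is_level_factor n M (f x) t \<longleftrightarrow> t = level_factor n M (f x)" if "x \<in> X" for x t
    using assms(3)[OF that] assms(2) by (rule is_level_factor_iff)
  have pos: "0 < level_factor n M (f x)" if "x \<in> X" for x
    using assms(3)[OF that] assms(2) by (rule level_factor_pos)
  have "level_factor n M (f x) \<le> T" if "x \<in> X" for x
  proof -
    have "level_factor n M (f x) * tuple_norm n (f x0) \<le>
        level_factor n M (f x) * tuple_norm n (f x)"
      using pos[OF that] x0(2)[OF that] by simp
    also have "\<dots> \<le> (M - 1) / (M + 1)"
      using is_level_factor_bounds(2) level that assms(2) by blast
    finally show ?thesis
      using assms(3)[OF x0(1)] unfolding T_def by (subst pos_le_divide_eq)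
  qed
  moreover have "(\<lambda>x. (x, level_factor n M (f x))) ` X =
      {y \<in> X \<times> {0..}. is_level_factor n M (f (fst y)) (snd y)}"
    using level pos by (auto simp: less_imp_le)
  then have "closed ((\<lambda>x. (x, level_factor n M (f x))) ` X)"
    using closed_is_level_factor[OF compact_imp_closed[OF assms(1)] assms(2) cont] by simp
  ultimately show ?thesis
    using pos by (intro continuous_from_closed_graph[of "{0..T}"]) (auto simp: less_imp_le)
qed simp

lemma ex_circle_extrema_along_path:
  fixes f :: "real \<Rightarrow> nat \<Rightarrow> complex"
  assumes "real n < M" "\<And>k. k < n \<Longrightarrow> continuous_on {0..1} (\<lambda>s. f s k)"
    and "\<And>s. s \<in> {0..1} \<Longrightarrow> 0 < tuple_norm n (f s)"
    and "tuple_norm n (f 0) < 1" "M \<le> circle_max n (f 0)" "m \<le> circle_min n (f 0)"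
    and "tuple_norm n (f 1) < 1" "circle_max n (f 1) \<le> M" "circle_min n (f 1) \<le> m"
  obtains d where "tuple_norm n d < 1" "circle_max n d = M" "circle_min n d = m"
proof -
  define g where "g = (\<lambda>s. level_tuple n M (f s))"
  have g: "tuple_norm n (g s) < 1" "circle_max n (g s) = M" if "s \<in> {0..1}" for s
    unfolding g_def using assms(3)[OF that] assms(1)
    by (rule tuple_norm_level_tuple, rule circle_max_level_tuple)
  have "continuous_on {0..1} (\<lambda>s. circle_min n (g s))"
    using g assms(1-3)
    by (intro continuous_on_circle_extrema)
       (auto simp: g_def level_tuple_def tuple_scale_def
          intro!: continuous_intros continuous_on_level_factor)
  moreover have "m \<le> circle_min n (g 0)" "circle_min n (g 1) \<le> m"
    using circle_min_le_level_tuple[of n "f 0" M] level_tuple_le_circle_min[of n "f 1" M] assms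
    by (auto simp: g_def)
  ultimately obtain s where "s \<in> {0..1}" "circle_min n (g s) = m"
    using IVT2'[of "\<lambda>s. circle_min n (g s)" 1 m 0] by auto
  then show ?thesis
    using g that by blast
qed

lemma ex_rotation_to_ray:
  fixes u v :: complex
  assumes "u \<noteq> 0"
  obtains c x where "norm c = 1" "0 \<le> x" "c * v = of_real x * u"
proof (cases "v = 0")
  case True
  then show ?thesis
    using that[of 1 0] by simp
next
  case False
  show ?thesis
  proof
    show "norm (sgn u / sgn v) = 1"
      using assms False by (simp add: norm_divide norm_sgn)
    show "sgn u / sgn v * v = of_real (norm v / norm u) * u"
      using assms False by (simp add: sgn_eq field_simps)
  qed simp
qed

lemma ex_rotation_segment_avoids_zero:
  assumes "0 < tuple_norm n a" "0 < tuple_norm n b"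
  obtains c where "norm c = 1"
    "\<And>s. s \<in> {0..1} \<Longrightarrow> 0 < tuple_norm n (\<lambda>k. of_real (1 - s) * a k + of_real s * tuple_scale c b k)"
proof -
  obtain j where j: "j < n" "a j \<noteq> 0"
    using assms(1) by (auto simp: tuple_norm_pos_iff)
  obtain c x where c: "norm c = 1" "0 \<le> x" "c * b j = of_real x * a j"
    using ex_rotation_to_ray[OF j(2)] .
  have "0 < tuple_norm n (\<lambda>k. of_real (1 - s) * a k + of_real s * tuple_scale c b k)"
    if s: "s \<in> {0..1}" for s
  proof (cases "s = 1")
    case True
    then show ?thesis
      using assms(2) c(1) by (simp add: tuple_norm_scale)
  next
    case False
    have "of_real (1 - s) * a j + of_real s * tuple_scale c b j = of_real (1 - s + s * x) * a j"
      unfolding tuple_scale_def c(3) by (simp add: algebra_simps)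
    moreover have "0 < 1 - s + s * x"
      using s False c(2) by (intro add_pos_nonneg) auto
    ultimately have "of_real (1 - s) * a j + of_real s * tuple_scale c b j \<noteq> 0"
      using j(2) by (metis less_irrefl mult_eq_0_iff of_real_eq_0_iff)
    then show ?thesis
      using j(1) unfolding tuple_norm_pos_iff by blast
  qed
  then show ?thesis
    using c(1) that by blast
qed

lemma ex_circle_extrema_between:
  assumes "real n < M" "0 < tuple_norm n a" "0 < tuple_norm n b"
    and "tuple_norm n a < 1" "M \<le> circle_max n a" "m \<le> circle_min n a"
    and "tuple_norm n b < 1" "circle_max n b \<le> M" "circle_min n b \<le> m"
  obtains d where "tuple_norm n d < 1" "circle_max n d = M" "circle_min n d = m"
proof -
  obtain c where c: "norm c = 1"
    and pos: "\<And>s. s \<in> {0..1} \<Longrightarrow>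
      0 < tuple_norm n (\<lambda>k. of_real (1 - s) * a k + of_real s * tuple_scale c b k)"
    using ex_rotation_segment_avoids_zero[OF assms(2,3)] by blast
  show ?thesis
  proof (rule ex_circle_extrema_along_path[OF assms(1) _ pos])
    show "continuous_on {0..1} (\<lambda>s. of_real (1 - s) * a k + of_real s * tuple_scale c b k)" for k
      by (intro continuous_intros)
  qed (use assms c that in \<open>simp_all add: circle_extrema_rotate tuple_norm_scale\<close>)
qed

lemma ex_circle_max_ge_circle_min_ge:
  assumes "0 < n" "real n < M"
  obtains a where "0 < tuple_norm n a" "tuple_norm n a < 1" "M \<le> circle_max n a"
    "real n - 1 + real n / M \<le> circle_min n a"
proof -
  define p where "p = real n / M"
  have p: "0 < p" "p < 1" "real n / p = M"
    using assms by (auto simp: p_def)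
  obtain a where a: "\<And>k. k < n \<Longrightarrow> norm (a k) < 1" "poisson_sum n a 1 = M"
    and sign: "\<And>z. norm z = 1 \<Longrightarrow> 0 \<le> (1 - p) * (poisson_sum n a z - (real n - 1 + p))"
    using extremal_zeros[OF p(1), of n] p(3) by metis
  have small: "tuple_norm n a < 1"
    using a(1) by (simp add: tuple_norm_less_iff)
  moreover have max: "M \<le> circle_max n a"
    using poisson_sum_le_circle_max[OF small, of 1] a(2) by simp
  moreover have "0 < tuple_norm n a"
    using max assms(2) circle_extrema_zero(1)[of n a] tuple_norm_nonneg[of n a] by force
  moreover have "real n - 1 + p \<le> circle_min n a"
    using sign p(2) by (intro circle_min_ge) (simp add: zero_le_mult_iff)
  ultimately show ?thesis
    using that by (simp add: p_def)
qed

lemma ex_circle_max_le_circle_min_le: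
  assumes "0 < n" "real n < M"
  obtains b where "0 < tuple_norm n b" "tuple_norm n b < 1" "circle_max n b \<le> M"
    "circle_min n b \<le> real n / (M - real n + 1)"
proof -
  define p where "p = M - real n + 1"
  have p: "0 < p" "1 < p"
    using assms by (auto simp: p_def)
  obtain b where b: "\<And>k. k < n \<Longrightarrow> norm (b k) < 1" "poisson_sum n b 1 = real n / p"
    and sign: "\<And>z. norm z = 1 \<Longrightarrow> 0 \<le> (1 - p) * (poisson_sum n b z - (real n - 1 + p))"
    using extremal_zeros[OF p(1), of n] by metis
  have small: "tuple_norm n b < 1"
    using b(1) by (simp add: tuple_norm_less_iff)
  moreover have min: "circle_min n b \<le> real n / p"
    using circle_min_le_poisson_sum[OF small, of 1] b(2) by simp
  moreover have "real n / p < real n"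
    using assms(1) p by (simp add: divide_less_eq)
  then have "0 < tuple_norm n b"
    using min circle_extrema_zero(2)[of n b] tuple_norm_nonneg[of n b] by force
  moreover have "circle_max n b \<le> real n - 1 + p"
    using sign p(2) by (intro circle_max_le) (simp add: zero_le_mult_iff)
  ultimately show ?thesis
    using that by (simp add: p_def)
qed

lemma ex_circle_extrema:
  assumes "0 < n" "real n < M"
    and "real n / (M - real n + 1) \<le> m" "m \<le> real n - 1 + real n / M"
  obtains d where "tuple_norm n d < 1" "circle_max n d = M" "circle_min n d = m"
proof -
  obtain a where a: "0 < tuple_norm n a" "tuple_norm n a < 1" "M \<le> circle_max n a"
    "m \<le> circle_min n a"
    using ex_circle_max_ge_circle_min_ge[OF assms(1,2)] order_trans[OF assms(4)] by metis
  obtain b where b: "0 < tuple_norm n b" "tuple_norm n b < 1" "circle_max n b \<le> M"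
    "circle_min n b \<le> m"
    using ex_circle_max_le_circle_min_le[OF assms(1,2)] order_trans[OF _ assms(3)] by metis
  show ?thesis
    using ex_circle_extrema_between[OF assms(2) a(1) b(1) a(2-4) b(2-4)] that .
qed

theorem theorem1:
  fixes n :: nat and m M :: real
  assumes "m > 0" and "M > 0"
    and "real n / (M - real n + 1) \<le> m" and "m \<le> real n - 1 + real n / M"
    and "m \<le> real n" and "real n \<le> M"
  shows "\<exists>B. is_blaschke n B \<and> maxderiv B = M \<and> minderiv B = m"
proof -
  obtain d where d: "tuple_norm n d < 1" "circle_max n d = M" "circle_min n d = m"
  proof (cases "M = real n")
    case True
    then have "m = M"
      using assms(3,5) by simp
    then show ?thesis
      using that[of "\<lambda>k. 0"] circle_extrema_zero[of n "\<lambda>k. 0"] True by (simp add: tuple_norm_zero)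
  next
    case False
    then have "0 < n" "real n < M"
      using assms(1,5,6) by simp_all
    then show ?thesis
      using ex_circle_extrema[OF _ _ assms(3,4)] that by blast
  qed
  have "is_blaschke n (blaschke 1 d n)"
    unfolding is_blaschke_def using d(1)
    by (intro exI[of _ 1] exI[of _ d]) (simp add: tuple_norm_less_iff)
  then show ?thesis
    using d by (metis maxderiv_blaschke minderiv_blaschke norm_one)
qed

end
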